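(* Let $f:\Omega\to\Omega$ be a measurable map with an ergodic invariant probability measure $\mu$, let $(\gamma_n)$ be a non-increasing sequence of non-negative real numbers, and let $\mathscr{B}_1$ and $\mathscr{B}_2$ be two Banach spaces of measurable functions on $\Omega$ such that: (i) the constant functions belong to $\mathscr{B}_1$; (ii) integration with respect to $\mu$ defines a continuous linear functional on $\mathscr{B}_1$; (iii) the Koopman operator $U\psi=\psi\circ f$ is continuous in $\mathscr{B}_1$; (iv) $\mathscr{B}_2$ is contained in the dual of $\mathscr{B}_1$ (duality with respect to integration by $\mu$, i.e. via $(\psi_1,\psi_2)\mapsto\int\psi_1\psi_2\,d\mu$) with a topology at least as fine as the dual norm topology. Assume that for any $\psi_1\in\mathscr{B}_1$ and $\psi_2\in\mathscr{B}_2$ there is a constant $C_{\psi_1,\psi_2}$ such that for any integer $n$ $$\left|\int\psi_1\circ f^n\,\psi_2\,d\mu-\int\psi_1\,d\mu\int\psi_2\,d\mu\right|\le C_{\psi_1,\psi_2}\,\gamma_n .$$ Then there exists a constant $K$ such that for any integer $n$ and any $\psi_1\in\mathscr{B}_1$, $\psi_2\in\mathscr{B}_2$, $$\left|\int\psi_1\circ f^n\,\psi_2\,d\mu-\int\psi_1\,d\mu\int\psi_2\,d\mu\right|\le K\,\Vert\psi_1\Vert_{\mathscr{B}_1}\Vert\psi_2\Vert_{\mathscr{B}_2}\,\gamma_n .$$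
   Context: The integers $n$ are non-negative integers indexing the sequence $(\gamma_n)$; $f^n$ is the $n$-th iterate of $f$. The norms of $\mathscr{B}_1$ and $\mathscr{B}_2$ are denoted $\Vert\cdot\Vert_{\mathscr{B}_1}$ and $\Vert\cdot\Vert_{\mathscr{B}_2}$. *)

theory Defs
  imports "HOL-Probability.Probability"
begin

(* Scalars are a type of sort {real_normed_field, banach, second_countable_topology}, so that
   real-valued and complex-valued functions are covered at once. The underlying set of a
   dynamical system is space M. *)

locale ergodic_system = prob_space M for M :: "'a measure" +
  fixes f :: "'a \<Rightarrow> 'a"
  assumes measurable_map: "f \<in> measurable M M"
    and invariant: "distr M M f = M"
    and ergodic: "\<And>A. A \<in> sets M \<Longrightarrow> f -` A \<inter> space M = A \<Longrightarrow> prob A = 0 \<or> prob A = 1"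

(* A Banach space of measurable functions is a linear set B of functions with a complete norm N.
   Only "N \<psi> = 0 implies \<psi> = 0 a.e." is demanded in place of definiteness. This allows both
   spaces of genuine functions (where N \<psi> = 0 holds only for the zero function) and spaces such
   as L^p, whose elements are classes of a.e. equal functions: there B contains all
   representatives, and two of them are the same element when N of their difference is 0. *)
locale banach_function_space =
  fixes M :: "'a measure"
    and B :: "('a \<Rightarrow> 'k::{real_normed_field, banach, second_countable_topology}) set"
    and N :: "('a \<Rightarrow> 'k) \<Rightarrow> real"
  assumes measurable_functions: "B \<subseteq> borel_measurable M"
    and zero_mem: "(\<lambda>_. 0) \<in> B"
    and add_mem: "\<And>\<psi> \<phi>. \<psi> \<in> B \<Longrightarrow> \<phi> \<in> B \<Longrightarrow> (\<lambda>x. \<psi> x + \<phi> x) \<in> B"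
    and scale_mem: "\<And>c \<psi>. \<psi> \<in> B \<Longrightarrow> (\<lambda>x. c * \<psi> x) \<in> B"
    and norm_nonneg: "\<And>\<psi>. \<psi> \<in> B \<Longrightarrow> 0 \<le> N \<psi>"
    and norm_triangle: "\<And>\<psi> \<phi>. \<psi> \<in> B \<Longrightarrow> \<phi> \<in> B \<Longrightarrow> N (\<lambda>x. \<psi> x + \<phi> x) \<le> N \<psi> + N \<phi>"
    and norm_scale: "\<And>c \<psi>. \<psi> \<in> B \<Longrightarrow> N (\<lambda>x. c * \<psi> x) = norm c * N \<psi>"
    and norm_definite: "\<And>\<psi>. \<psi> \<in> B \<Longrightarrow> N \<psi> = 0 \<Longrightarrow> AE x in M. \<psi> x = 0"
    and complete: "\<And>\<Psi> :: nat \<Rightarrow> 'a \<Rightarrow> 'k. (\<And>i. \<Psi> i \<in> B) \<Longrightarrow>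
      (\<And>e. e > 0 \<Longrightarrow> \<exists>m. \<forall>i\<ge>m. \<forall>j\<ge>m. N (\<lambda>x. \<Psi> i x - \<Psi> j x) < e) \<Longrightarrow>
      \<exists>\<psi>\<in>B. (\<lambda>i. N (\<lambda>x. \<Psi> i x - \<psi> x)) \<longlonglongrightarrow> 0"

definition norm_topology ::
    "('a \<Rightarrow> 'k::real_normed_field) set \<Rightarrow> (('a \<Rightarrow> 'k) \<Rightarrow> real) \<Rightarrow> ('a \<Rightarrow> 'k) topology" where
  "norm_topology B N = topology (\<lambda>U. U \<subseteq> B \<and>
     (\<forall>\<psi>\<in>U. \<exists>e>0. \<forall>\<phi>\<in>B. N (\<lambda>x. \<phi> x - \<psi> x) < e \<longrightarrow> \<phi> \<in> U))"

lemma openin_norm_topology: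
  "openin (norm_topology B N) U \<longleftrightarrow>
     U \<subseteq> B \<and> (\<forall>\<psi>\<in>U. \<exists>e>0. \<forall>\<phi>\<in>B. N (\<lambda>x. \<phi> x - \<psi> x) < e \<longrightarrow> \<phi> \<in> U)"
proof -
  let ?P = "\<lambda>U. U \<subseteq> B \<and>
     (\<forall>\<psi>\<in>U. \<exists>e>0. \<forall>\<phi>\<in>B. N (\<lambda>x. \<phi> x - \<psi> x) < e \<longrightarrow> \<phi> \<in> U)"
  have "?P (S \<inter> T)" if S: "?P S" and T: "?P T" for S T
  proof (intro conjI ballI)
    show "S \<inter> T \<subseteq> B" using S by blast
    fix \<psi> assume "\<psi> \<in> S \<inter> T"
    then obtain d e where
      "d > 0" "\<forall>\<phi>\<in>B. N (\<lambda>x. \<phi> x - \<psi> x) < d \<longrightarrow> \<phi> \<in> S"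
      "e > 0" "\<forall>\<phi>\<in>B. N (\<lambda>x. \<phi> x - \<psi> x) < e \<longrightarrow> \<phi> \<in> T"
      using S T by blast
    then show "\<exists>e>0. \<forall>\<phi>\<in>B. N (\<lambda>x. \<phi> x - \<psi> x) < e \<longrightarrow> \<phi> \<in> S \<inter> T"
      by (intro exI[of _ "min d e"]) auto
  qed
  moreover have "?P (\<Union>\<K>)" if "\<forall>K\<in>\<K>. ?P K" for \<K>
    using that by (meson Sup_le_iff Union_iff)
  ultimately have "istopology ?P"
    unfolding istopology_def by blast
  then show ?thesis
    unfolding norm_topology_def by (simp add: topology_inverse')
qed

lemma topspace_norm_topology: "topspace (norm_topology B N) = B"
proof
  show "topspace (norm_topology B N) \<subseteq> B"
    using openin_topspace openin_norm_topology by blast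
  have "openin (norm_topology B N) B"
    unfolding openin_norm_topology by (auto intro: exI[of _ 1])
  then show "B \<subseteq> topspace (norm_topology B N)"
    by (rule openin_subset)
qed

definition dual_space ::
    "('a \<Rightarrow> 'k::real_normed_field) set \<Rightarrow> (('a \<Rightarrow> 'k) \<Rightarrow> real) \<Rightarrow> (('a \<Rightarrow> 'k) \<Rightarrow> 'k) set" where
  "dual_space B N = {l.
     (\<forall>\<psi>\<in>B. \<forall>\<phi>\<in>B. l (\<lambda>x. \<psi> x + \<phi> x) = l \<psi> + l \<phi>) \<and>
     (\<forall>c. \<forall>\<psi>\<in>B. l (\<lambda>x. c * \<psi> x) = c * l \<psi>) \<and>
     continuous_map (norm_topology B N) euclidean l}"

definition dual_norm ::
    "('a \<Rightarrow> 'k::real_normed_field) set \<Rightarrow> (('a \<Rightarrow> 'k) \<Rightarrow> real) \<Rightarrow> (('a \<Rightarrow> 'k) \<Rightarrow> 'k) \<Rightarrow> real" where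
  "dual_norm B N l = (SUP \<psi>\<in>{\<psi>\<in>B. N \<psi> \<le> 1}. norm (l \<psi>))"

(* The functional on functions which \<phi> represents via integration. *)
definition pairing ::
    "'a measure \<Rightarrow> ('a \<Rightarrow> 'k) \<Rightarrow> ('a \<Rightarrow> 'k::{real_normed_field, banach, second_countable_topology}) \<Rightarrow> 'k" where
  "pairing M \<phi> = (\<lambda>\<psi>. \<integral>x. \<psi> x * \<phi> x \<partial>M)"

(* The integral of a non-integrable function is 0 by convention, hence the explicit
   integrability requirements in the next two definitions. *)
definition integral_continuous_on ::
    "'a measure \<Rightarrow> ('a \<Rightarrow> 'k::{real_normed_field, banach, second_countable_topology}) set
      \<Rightarrow> (('a \<Rightarrow> 'k) \<Rightarrow> real) \<Rightarrow> bool" where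
  "integral_continuous_on M B N \<longleftrightarrow>
     (\<forall>\<psi>\<in>B. integrable M \<psi>) \<and> (\<lambda>\<psi>. \<integral>x. \<psi> x \<partial>M) \<in> dual_space B N"

(* Being contained in the dual means that every element of B2 defines, by integration, a
   continuous functional on B1. The topology of N2 is compared with the one that the dual norm
   induces on B2 through this identification. *)
definition contained_in_dual ::
    "'a measure \<Rightarrow> ('a \<Rightarrow> 'k::{real_normed_field, banach, second_countable_topology}) set
      \<Rightarrow> (('a \<Rightarrow> 'k) \<Rightarrow> real) \<Rightarrow> ('a \<Rightarrow> 'k) set \<Rightarrow> (('a \<Rightarrow> 'k) \<Rightarrow> real) \<Rightarrow> bool" where
  "contained_in_dual M B1 N1 B2 N2 \<longleftrightarrow>
     (\<forall>\<psi>2\<in>B2. (\<forall>\<psi>1\<in>B1. integrable M (\<lambda>x. \<psi>1 x * \<psi>2 x)) \<and> pairing M \<psi>2 \<in> dual_space B1 N1) \<and>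
     (\<forall>U. openin (norm_topology B2 (\<lambda>\<psi>2. dual_norm B1 N1 (pairing M \<psi>2))) U \<longrightarrow>
          openin (norm_topology B2 N2) U)"

definition koopman :: "('a \<Rightarrow> 'a) \<Rightarrow> ('a \<Rightarrow> 'k) \<Rightarrow> 'a \<Rightarrow> 'k" where
  "koopman f \<psi> = \<psi> \<circ> f"

end

theory Submission
  imports Defs
begin

text \<open>
  Fix \<open>\<psi>1\<close>. The functionals \<open>\<psi>2 \<mapsto> (\<integral>\<psi>1 \<circ> f^n \<psi>2 - \<integral>\<psi>1 \<integral>\<psi>2) / \<gamma> n\<close> are continuous by
  the duality hypothesis and pointwise bounded by the decay hypothesis, so by the uniform
  boundedness principle on \<open>B2\<close> they are bounded by \<open>C(\<psi>1) N2 \<psi>2\<close> for all \<open>n\<close>. Hence the functionals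
  of \<open>\<psi>1\<close>, indexed by \<open>(n, \<psi>2)\<close> and divided by \<open>N2 \<psi>2\<close>, are pointwise bounded on \<open>B1\<close>; they are
  continuous because the Koopman operator is, and a second application of the principle, now on
  \<open>B1\<close>, gives \<open>K\<close>.
\<close>

section \<open>Norm estimates, and the passage from open sets to bounds\<close>

context banach_function_space
begin

lemma diff_mem:
  assumes "\<psi> \<in> B" "\<phi> \<in> B"
  shows "(\<lambda>x. \<psi> x - \<phi> x) \<in> B"
  using add_mem[OF assms(1) scale_mem[OF assms(2), of "-1"]] by simp

lemma norm_zero: "N (\<lambda>_. 0) = 0"
  using norm_scale[OF zero_mem, of 0] by simp

lemma norm_minus_commute:
  assumes "\<psi> \<in> B" "\<phi> \<in> B"
  shows "N (\<lambda>x. \<psi> x - \<phi> x) = N (\<lambda>x. \<phi> x - \<psi> x)"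
  using norm_scale[OF diff_mem[OF assms], of "-1"] by simp

lemma norm_triangle_diff:
  assumes "\<psi> \<in> B" "\<phi> \<in> B" "\<xi> \<in> B"
  shows "N (\<lambda>x. \<psi> x - \<xi> x) \<le> N (\<lambda>x. \<psi> x - \<phi> x) + N (\<lambda>x. \<phi> x - \<xi> x)"
  using norm_triangle[OF diff_mem[OF assms(1,2)] diff_mem[OF assms(2,3)]] by simp

lemma openin_norm_ball: "openin (norm_topology B N) {\<psi>\<in>B. N \<psi> < r}"
  unfolding openin_norm_topology
proof (intro conjI ballI)
  fix \<psi> assume \<psi>: "\<psi> \<in> {\<psi>\<in>B. N \<psi> < r}"
  have "N \<phi> < r" if "\<phi> \<in> B" "N (\<lambda>x. \<phi> x - \<psi> x) < r - N \<psi>" for \<phi>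
    using norm_triangle[OF diff_mem[OF that(1), of \<psi>], of \<psi>] \<psi> that by simp
  then show "\<exists>e>0. \<forall>\<phi>\<in>B. N (\<lambda>x. \<phi> x - \<psi> x) < e \<longrightarrow> \<phi> \<in> {\<psi>\<in>B. N \<psi> < r}"
    using \<psi> by (intro exI[of _ "r - N \<psi>"]) auto
qed auto

text \<open>Rescaling: a multiple t \<psi> with t \<open>N \<psi>\<close> < e lies in the ball, so t
  \<open>p \<psi>\<close> is at most C. The case \<open>N \<psi> = 0\<close> is genuine, since
  \<open>N\<close> may vanish on nonzero functions; then every t > 0 is allowed. No sign of
  \<open>p\<close> is assumed.\<close>

lemma homogeneous_bound:
  assumes scale: "\<And>c \<psi>. \<psi> \<in> B \<Longrightarrow> p (\<lambda>x. c * \<psi> x) = norm c * p \<psi>"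
    and "e > 0" and near: "\<And>\<psi>. \<psi> \<in> B \<Longrightarrow> N \<psi> < e \<Longrightarrow> p \<psi> \<le> C"
    and \<psi>: "\<psi> \<in> B"
  shows "p \<psi> \<le> 2 * C / e * N \<psi>"
proof -
  have *: "t * p \<psi> \<le> C" if "t > 0" "t * N \<psi> < e" for t
    using near[OF scale_mem[OF \<psi>, of "of_real t"]] that by (simp add: scale norm_scale \<psi>)
  show ?thesis
  proof (cases "N \<psi> = 0")
    case True
    have "p \<psi> \<le> 0"
    proof (rule ccontr)
      assume "\<not> p \<psi> \<le> 0"
      \<comment> \<open>This t gives t \<open>p \<psi>\<close> = |C| + 1, which exceeds C.\<close>
      then show False
        using *[of "(\<bar>C\<bar> + 1) / p \<psi>"] True \<open>e > 0\<close> by simp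
    qed
    then show ?thesis using True by simp
  next
    case False
    then have "N \<psi> > 0" using norm_nonneg[OF \<psi>] by simp
    \<comment> \<open>The strict inequality rules out t = e / \<open>N \<psi>\<close>; taking half
      of it costs the factor 2 in the bound.\<close>
    then show ?thesis
      using *[of "e / (2 * N \<psi>)"] \<open>e > 0\<close> by (simp add: field_simps)
  qed
qed

text \<open>The sublevel set contains the zero function, hence a ball around it, and homogeneity
  does the rest. In this form the continuity of functionals, the continuity of the Koopman operator
  and the comparison of topologies all turn into inequalities.\<close>

lemma openin_imp_bounded:
  assumes "openin (norm_topology B N) {\<psi>\<in>B. p \<psi> < 1}"
    and scale: "\<And>c \<psi>. \<psi> \<in> B \<Longrightarrow> p (\<lambda>x. c * \<psi> x) = norm c * p \<psi>"
  shows "\<exists>c. \<forall>\<psi>\<in>B. p \<psi> \<le> c * N \<psi>"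
proof -
  have "(\<lambda>_. 0) \<in> {\<psi>\<in>B. p \<psi> < 1}"
    using zero_mem scale[OF zero_mem, of 0] by simp
  then obtain e where "e > 0"
    and e: "\<And>\<phi>. \<phi> \<in> B \<Longrightarrow> N (\<lambda>x. \<phi> x - 0) < e \<Longrightarrow> \<phi> \<in> {\<psi>\<in>B. p \<psi> < 1}"
    using assms(1) unfolding openin_norm_topology by meson
  have "p \<psi> \<le> 1" if "\<psi> \<in> B" "N \<psi> < e" for \<psi>
    using e[of \<psi>] that by simp
  then show ?thesis
    using homogeneous_bound[of p e 1, OF scale \<open>e > 0\<close>] by blast
qed

lemma dual_space_bounded:
  assumes "l \<in> dual_space B N"
  shows "\<exists>c. \<forall>\<psi>\<in>B. norm (l \<psi>) \<le> c * N \<psi>"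
proof (rule openin_imp_bounded)
  have "continuous_map (norm_topology B N) euclidean l"
    using assms by (simp add: dual_space_def)
  from openin_continuous_map_preimage[OF this, of "ball 0 1"]
  show "openin (norm_topology B N) {\<psi>\<in>B. norm (l \<psi>) < 1}"
    by (simp add: topspace_norm_topology)
  show "norm (l (\<lambda>x. c * \<psi> x)) = norm c * norm (l \<psi>)" if "\<psi> \<in> B" for c \<psi>
    using assms that by (simp add: dual_space_def norm_mult)
qed

text \<open>A real supremum is informative only over a set that is bounded above, so the crude bound
  from continuity comes first. The factor 2 from \<open>homogeneous_bound\<close> is harmless,
  because only the existence of some constant matters later.\<close>

lemma dual_norm_bound:
  assumes l: "l \<in> dual_space B N" and \<psi>: "\<psi> \<in> B"
  shows "norm (l \<psi>) \<le> 2 * dual_norm B N l * N \<psi>"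
proof -
  obtain c where c: "\<And>\<psi>. \<psi> \<in> B \<Longrightarrow> norm (l \<psi>) \<le> c * N \<psi>"
    using dual_space_bounded[OF l] by blast
  have "norm (l \<psi>) \<le> \<bar>c\<bar>" if "\<psi> \<in> B" "N \<psi> \<le> 1" for \<psi>
  proof -
    have "c * N \<psi> \<le> \<bar>c\<bar> * 1"
      using that norm_nonneg by (intro mult_mono) auto
    then show ?thesis using c[OF that(1)] by simp
  qed
  then have bdd: "bdd_above ((\<lambda>\<psi>. norm (l \<psi>)) ` {\<psi>\<in>B. N \<psi> \<le> 1})"
    by (intro bdd_aboveI2[of _ _ "\<bar>c\<bar>"]) auto
  have "norm (l \<phi>) \<le> dual_norm B N l" if "\<phi> \<in> B" "N \<phi> < 1" for \<phi>
    unfolding dual_norm_def using that by (intro cSUP_upper bdd) auto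
  moreover have "norm (l (\<lambda>x. c * \<psi> x)) = norm c * norm (l \<psi>)" if "\<psi> \<in> B" for c \<psi>
    using l that by (simp add: dual_space_def norm_mult)
  ultimately show ?thesis
    using homogeneous_bound[of "\<lambda>\<psi>. norm (l \<psi>)" 1 "dual_norm B N l", OF _ _ _ \<psi>] by simp
qed

section \<open>Completeness and the uniform boundedness principle\<close>

lemma nested_balls:
  assumes X: "\<And>n. X n \<in> B" and r: "\<And>n. 0 < r n"
    and step: "\<And>n. N (\<lambda>x. X (Suc n) x - X n x) + r (Suc n) \<le> r n"
    and half: "\<And>n. r (Suc n) \<le> r n / 2"
  shows "\<exists>\<psi>\<in>B. \<forall>n. N (\<lambda>x. \<psi> x - X n x) \<le> r n"
proof -
  \<comment> \<open>The hypothesis \<open>step\<close> says that the closed balls are nested, and it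
    telescopes. As the radii tend to 0, the centres form a Cauchy sequence, whose limit stays in
    every ball.\<close>
  have dist: "N (\<lambda>x. X (n + k) x - X n x) + r (n + k) \<le> r n" for n k
  proof (induction k)
    case 0
    then show ?case using norm_zero by simp
  next
    case (Suc k)
    then show ?case
      using step[of "n + k"] norm_triangle_diff[OF X[of "Suc (n + k)"] X[of "n + k"] X[of n]] by simp
  qed
  have dist_le: "N (\<lambda>x. X i x - X n x) \<le> r n" if "i \<ge> n" for i n
    using dist[of n "i - n"] r[of i] that by simp
  have geo: "r n \<le> r 0 * (1/2) ^ n" for n
  proof (induction n)
    case (Suc n)
    then show ?case using half[of n] by simp
  qed simp
  have "(\<lambda>n. r 0 * (1/2) ^ n) \<longlonglongrightarrow> 0"
    by (intro tendsto_mult_right_zero LIMSEQ_power_zero) simp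
  have "r \<longlonglongrightarrow> 0"
    by (rule tendsto_sandwich[OF _ _ tendsto_const \<open>(\<lambda>n. r 0 * (1/2) ^ n) \<longlonglongrightarrow> 0\<close>])
      (use geo r in \<open>auto simp: less_imp_le\<close>)
  have "\<exists>m. \<forall>i\<ge>m. \<forall>j\<ge>m. N (\<lambda>x. X i x - X j x) < e" if "e > 0" for e
  proof -
    obtain m where "r m < e / 2"
      using order_tendstoD(2)[OF \<open>r \<longlonglongrightarrow> 0\<close>, of "e / 2"] \<open>e > 0\<close>
      by (auto simp: eventually_sequentially)
    then have "N (\<lambda>x. X i x - X j x) < e" if "i \<ge> m" "j \<ge> m" for i j
      using norm_triangle_diff[OF X[of i] X[of m] X[of j]] dist_le[OF that(1)] dist_le[OF that(2)]
        norm_minus_commute[OF X[of m] X[of j]] by simp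
    then show ?thesis by blast
  qed
  from complete[OF X this] obtain \<psi> where \<psi>: "\<psi> \<in> B" and lim: "(\<lambda>i. N (\<lambda>x. X i x - \<psi> x)) \<longlonglongrightarrow> 0"
    by blast
  have "N (\<lambda>x. \<psi> x - X n x) \<le> r n" for n
  proof (rule tendsto_lowerbound)
    show "(\<lambda>i. N (\<lambda>x. X i x - \<psi> x) + r n) \<longlonglongrightarrow> r n"
      using tendsto_add[OF lim tendsto_const[of "r n"]] by simp
    have "N (\<lambda>x. \<psi> x - X n x) \<le> N (\<lambda>x. X i x - \<psi> x) + r n" if "i \<ge> n" for i
      using norm_triangle_diff[OF \<psi> X[of i] X[of n]] dist_le[OF that] norm_minus_commute[OF \<psi> X[of i]]
      by simp
    then show "\<forall>\<^sub>F i in sequentially. N (\<lambda>x. \<psi> x - X n x) \<le> N (\<lambda>x. X i x - \<psi> x) + r n"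
      by (auto simp: eventually_sequentially)
  qed simp
  then show ?thesis using \<psi> by blast
qed

text \<open>A Baire argument by nested balls: without a common constant, every ball contains a
  smaller one on which some \<open>p i\<close> exceeds a prescribed level, and a point common to all
  these balls violates pointwise boundedness. Real-valued sublinear \<open>p i\<close> instead of
  operators leave room for quotients by \<gamma> n and by norms; each index may have its own
  constant in \<open>bounded\<close>.\<close>

lemma uniform_boundedness:
  fixes p :: "'i \<Rightarrow> ('a \<Rightarrow> 'k) \<Rightarrow> real"
  assumes triangle: "\<And>i \<psi> \<phi>. i \<in> I \<Longrightarrow> \<psi> \<in> B \<Longrightarrow> \<phi> \<in> B \<Longrightarrow> p i (\<lambda>x. \<psi> x + \<phi> x) \<le> p i \<psi> + p i \<phi>"
    and scale: "\<And>i c \<psi>. i \<in> I \<Longrightarrow> \<psi> \<in> B \<Longrightarrow> p i (\<lambda>x. c * \<psi> x) = norm c * p i \<psi>"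
    and bounded: "\<And>i. i \<in> I \<Longrightarrow> \<exists>c. \<forall>\<psi>\<in>B. p i \<psi> \<le> c * N \<psi>"
    and pointwise: "\<And>\<psi>. \<psi> \<in> B \<Longrightarrow> \<exists>c. \<forall>i\<in>I. p i \<psi> \<le> c"
  shows "\<exists>K. \<forall>i\<in>I. \<forall>\<psi>\<in>B. p i \<psi> \<le> K * N \<psi>"
proof (rule ccontr)
  assume unbounded: "\<not> ?thesis"
  \<comment> \<open>If all \<open>p i\<close> were at most m on one ball, translating it to the
    origin would bound them all by m + m there, and \<open>homogeneous_bound\<close> would give a
    constant independent of i.\<close>
  have escape: "\<exists>y\<in>B. N (\<lambda>x. y x - z x) < r \<and> (\<exists>i\<in>I. p i y > m)"
    if z: "z \<in> B" and "r > 0" for z r m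
  proof (rule ccontr)
    assume "\<not> ?thesis"
    then have le: "p i y \<le> m" if "i \<in> I" "y \<in> B" "N (\<lambda>x. y x - z x) < r" for i y
      using that by force
    have "p i \<psi> \<le> 2 * (m + m) / r * N \<psi>" if i: "i \<in> I" and \<psi>: "\<psi> \<in> B" for i \<psi>
    proof (rule homogeneous_bound[OF scale[OF i] \<open>r > 0\<close> _ \<psi>])
      fix \<phi> assume \<phi>: "\<phi> \<in> B" "N \<phi> < r"
      \<comment> \<open>A small \<phi> is the difference of two points of the ball around z, namely
        \<phi> + z and z.\<close>
      have "p i (\<lambda>x. (\<phi> x + z x) + (-1) * z x) \<le> p i (\<lambda>x. \<phi> x + z x) + p i (\<lambda>x. (-1) * z x)"
        by (intro triangle i add_mem scale_mem \<phi> z)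
      also have "p i (\<lambda>x. (-1) * z x) = p i z"
        using scale[OF i z, of "-1"] by simp
      finally show "p i \<phi> \<le> m + m"
        using le[OF i add_mem[OF \<phi>(1) z]] le[OF i z] \<phi> \<open>r > 0\<close> by (simp add: norm_zero)
    qed
    then show False using unbounded by blast
  qed
  have shrink: "\<exists>y s. y \<in> B \<and> s > 0 \<and> N (\<lambda>x. y x - z x) + s \<le> r \<and> s \<le> r / 2 \<and>
      (\<exists>i\<in>I. \<forall>w\<in>B. N (\<lambda>x. w x - y x) \<le> s \<longrightarrow> p i w > m)"
    if z: "z \<in> B" and "r > 0" for z r m
  proof -
    obtain y i where y: "y \<in> B" "N (\<lambda>x. y x - z x) < r / 2" and i: "i \<in> I" "p i y > m + 1"
      using escape[OF z, of "r / 2" "m + 1"] \<open>r > 0\<close> by auto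
    obtain c where c: "\<And>\<psi>. \<psi> \<in> B \<Longrightarrow> p i \<psi> \<le> c * N \<psi>"
      using bounded[OF i(1)] by blast
    \<comment> \<open>Radius r / 2 fits around y inside the old ball and halves the radius. The
      other term limits the drop of \<open>p i\<close> from its value at y to at most 1, so a value
      above m + 1 at y stays above m on the whole new ball.\<close>
    define s where "s = min (r / 2) (1 / (\<bar>c\<bar> + 1))"
    have "s > 0" using \<open>r > 0\<close> by (simp add: s_def)
    moreover have "p i w > m" if w: "w \<in> B" "N (\<lambda>x. w x - y x) \<le> s" for w
    proof -
      have "p i y \<le> p i w + p i (\<lambda>x. y x - w x)"
        using triangle[OF i(1) w(1) diff_mem[OF y(1) w(1)]] by simp
      also have "p i (\<lambda>x. y x - w x) \<le> c * N (\<lambda>x. w x - y x)"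
        using c[OF diff_mem[OF y(1) w(1)]] norm_minus_commute[OF y(1) w(1)] by simp
      also have "\<dots> \<le> (\<bar>c\<bar> + 1) * (1 / (\<bar>c\<bar> + 1))"
        using w(2) norm_nonneg[OF diff_mem[OF w(1) y(1)]]
        by (intro mult_mono) (auto simp: s_def)
      also have "\<dots> = 1" by (simp add: field_simps)
      finally show ?thesis using i(2) by simp
    qed
    ultimately show ?thesis
      using y i(1) by (intro exI[of _ y] exI[of _ s]) (auto simp: s_def)
  qed
  \<comment> \<open>A ball is coded as a pair of centre and radius; the level to be exceeded at
    stage n is n.\<close>
  define step where "step n b b' \<longleftrightarrow>
      N (\<lambda>x. fst b' x - fst b x) + snd b' \<le> snd b \<and> snd b' \<le> snd b / 2 \<and>
      (\<exists>i\<in>I. \<forall>w\<in>B. N (\<lambda>x. w x - fst b' x) \<le> snd b' \<longrightarrow> p i w > real n)"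
    for n :: nat and b b' :: "('a \<Rightarrow> 'k) \<times> real"
  have "\<exists>g. \<forall>n. (fst (g n) \<in> B \<and> 0 < snd (g n)) \<and> step n (g n) (g (Suc n))"
  proof (rule dependent_nat_choice)
    show "\<exists>b :: ('a \<Rightarrow> 'k) \<times> real. fst b \<in> B \<and> 0 < snd b"
      using zero_mem by (intro exI[of _ "((\<lambda>_. 0), 1)"]) simp
    show "\<exists>b'. (fst b' \<in> B \<and> 0 < snd b') \<and> step n b b'" if b: "fst b \<in> B \<and> 0 < snd b" for b n
    proof -
      obtain y s where "y \<in> B \<and> s > 0 \<and> N (\<lambda>x. y x - fst b x) + s \<le> snd b \<and> s \<le> snd b / 2 \<and>
          (\<exists>i\<in>I. \<forall>w\<in>B. N (\<lambda>x. w x - y x) \<le> s \<longrightarrow> p i w > real n)"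
        using shrink[of "fst b" "snd b" "real n"] b by blast
      then show ?thesis
        unfolding step_def by (intro exI[of _ "(y, s)"]) simp
    qed
  qed
  then obtain g where g: "\<And>n. fst (g n) \<in> B" "\<And>n. 0 < snd (g n)" "\<And>n. step n (g n) (g (Suc n))"
    by blast
  obtain \<psi> where \<psi>: "\<psi> \<in> B" "\<And>n. N (\<lambda>x. \<psi> x - fst (g n) x) \<le> snd (g n)"
    using nested_balls[of "\<lambda>n. fst (g n)" "\<lambda>n. snd (g n)"] g unfolding step_def by blast
  have large: "\<exists>i\<in>I. p i \<psi> > real n" for n
    using g(3)[of n] \<psi> unfolding step_def by blast
  obtain c where c: "\<And>i. i \<in> I \<Longrightarrow> p i \<psi> \<le> c"
    using pointwise[OF \<psi>(1)] by blast
  obtain n where "real n > c"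
    using reals_Archimedean2 by blast
  then show False
    using large[of n] c by force
qed

section \<open>The Koopman operator and the duality pairing\<close>

lemma koopman_iterate_bounded:
  assumes cont: "continuous_map (norm_topology B N) (norm_topology B N) (koopman f)"
  shows "\<exists>c\<ge>0. \<forall>\<psi>\<in>B. \<psi> \<circ> f ^^ n \<in> B \<and> N (\<psi> \<circ> f ^^ n) \<le> c * N \<psi>"
proof -
  have mem: "\<psi> \<circ> f \<in> B" if "\<psi> \<in> B" for \<psi>
    using continuous_map_image_subset_topspace[OF cont] that
    by (auto simp: topspace_norm_topology koopman_def)
  have "\<exists>c. \<forall>\<psi>\<in>B. N (\<psi> \<circ> f) \<le> c * N \<psi>"
  proof (rule openin_imp_bounded)
    have "{\<psi>\<in>B. N (\<psi> \<circ> f) < 1} = {\<psi>\<in>B. koopman f \<psi> \<in> {\<psi>\<in>B. N \<psi> < 1}}"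
      using mem by (auto simp: koopman_def)
    then show "openin (norm_topology B N) {\<psi>\<in>B. N (\<psi> \<circ> f) < 1}"
      using openin_continuous_map_preimage[OF cont openin_norm_ball[of 1]]
      by (simp add: topspace_norm_topology)
    show "N ((\<lambda>x. c * \<psi> x) \<circ> f) = norm c * N (\<psi> \<circ> f)" if "\<psi> \<in> B" for c \<psi>
      using norm_scale[OF mem[OF that], of c] by (simp add: o_def)
  qed
  then obtain c where c: "\<And>\<psi>. \<psi> \<in> B \<Longrightarrow> N (\<psi> \<circ> f) \<le> c * N \<psi>"
    by blast
  \<comment> \<open>The absolute value matters because c may be negative if \<open>N\<close>
    vanishes on all of \<open>B\<close>. Growth of the constant with n does no harm: each n is used
    separately.\<close>
  have "\<psi> \<circ> f ^^ n \<in> B \<and> N (\<psi> \<circ> f ^^ n) \<le> \<bar>c\<bar> ^ n * N \<psi>" if "\<psi> \<in> B" for \<psi>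
  proof (induction n)
    case 0
    then show ?case using that by simp
  next
    case (Suc n)
    have eq: "\<psi> \<circ> f ^^ Suc n = (\<psi> \<circ> f ^^ n) \<circ> f"
      by (simp only: funpow_Suc_right o_assoc)
    have "N (\<psi> \<circ> f ^^ n \<circ> f) \<le> c * N (\<psi> \<circ> f ^^ n)"
      using c Suc by blast
    also have "\<dots> \<le> \<bar>c\<bar> * (\<bar>c\<bar> ^ n * N \<psi>)"
      using conjunct2[OF Suc] norm_nonneg[OF conjunct1[OF Suc]] by (intro mult_mono) (simp_all add: comp_def)
    finally show ?case
      unfolding eq using mem[OF conjunct1[OF Suc]] by (simp add: comp_def mult.assoc)
  qed
  then show ?thesis
    by (intro exI[of _ "\<bar>c\<bar> ^ n"]) auto
qed

end

text \<open>The dual norm controls this functional of \<psi>2, so its unit sublevel set is open for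
  the dual norm. The hypothesis compares topologies and not norms, so this set has to be carried
  over to \<open>N2\<close> before a bound can be read off.\<close>

lemma pairing_bounded:
  assumes "banach_function_space M B1 N1" and "banach_function_space M B2 N2"
    and dual: "contained_in_dual M B1 N1 B2 N2" and \<psi>1: "\<psi>1 \<in> B1"
  shows "\<exists>c. \<forall>\<psi>2\<in>B2. norm (\<integral>x. \<psi>1 x * \<psi>2 x \<partial>M) \<le> c * N2 \<psi>2"
proof -
  interpret B1: banach_function_space M B1 N1 by fact
  interpret B2: banach_function_space M B2 N2 by fact
  let ?D = "\<lambda>\<psi>2. dual_norm B1 N1 (pairing M \<psi>2)"
  have int: "integrable M (\<lambda>x. \<psi>1 x * \<psi>2 x)" if "\<psi>2 \<in> B2" for \<psi>2
    using dual that \<psi>1 by (auto simp: contained_in_dual_def)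
  have bound: "norm (\<integral>x. \<psi>1 x * \<psi>2 x \<partial>M) \<le> 2 * ?D \<psi>2 * N1 \<psi>1" if "\<psi>2 \<in> B2" for \<psi>2
  proof -
    have "pairing M \<psi>2 \<in> dual_space B1 N1"
      using dual that by (simp add: contained_in_dual_def)
    from B1.dual_norm_bound[OF this \<psi>1] show ?thesis
      by (simp add: pairing_def)
  qed
  show ?thesis
  proof (rule B2.openin_imp_bounded)
    have "openin (norm_topology B2 ?D) {\<psi>2\<in>B2. norm (\<integral>x. \<psi>1 x * \<psi>2 x \<partial>M) < 1}" (is "openin _ ?U")
      unfolding openin_norm_topology
    proof (intro conjI ballI)
      fix \<psi>2 assume \<psi>2: "\<psi>2 \<in> ?U"
      \<comment> \<open>Here d is the slack of \<psi>2 below 1. The summand 1 in the denominator of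
        e covers \<open>N1 \<psi>1 = 0\<close> and makes e (2 \<open>N1 \<psi>1\<close>) strictly
        less than d.\<close>
      define d where "d = 1 - norm (\<integral>x. \<psi>1 x * \<psi>2 x \<partial>M)"
      define e where "e = d / (2 * N1 \<psi>1 + 1)"
      have "d > 0" using \<psi>2 by (simp add: d_def)
      have pos: "2 * N1 \<psi>1 + 1 > 0" using B1.norm_nonneg[OF \<psi>1] by simp
      have "\<phi> \<in> ?U" if \<phi>: "\<phi> \<in> B2" "?D (\<lambda>x. \<phi> x - \<psi>2 x) < e" for \<phi>
      proof -
        have "(\<integral>x. \<psi>1 x * \<phi> x \<partial>M) = (\<integral>x. \<psi>1 x * \<psi>2 x \<partial>M) + (\<integral>x. \<psi>1 x * (\<phi> x - \<psi>2 x) \<partial>M)"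
          using \<psi>2 \<phi> by (simp add: right_diff_distrib int)
        then have "norm (\<integral>x. \<psi>1 x * \<phi> x \<partial>M) \<le> (1 - d) + norm (\<integral>x. \<psi>1 x * (\<phi> x - \<psi>2 x) \<partial>M)"
          by (simp add: d_def norm_triangle_ineq)
        also have "norm (\<integral>x. \<psi>1 x * (\<phi> x - \<psi>2 x) \<partial>M) \<le> ?D (\<lambda>x. \<phi> x - \<psi>2 x) * (2 * N1 \<psi>1)"
          using bound[OF B2.diff_mem[OF \<phi>(1), of \<psi>2]] \<psi>2 by (simp add: mult_ac)
        also have "\<dots> \<le> e * (2 * N1 \<psi>1)"
          using \<phi>(2) B1.norm_nonneg[OF \<psi>1] by (intro mult_right_mono) auto
        also have "\<dots> < d"
          using \<open>d > 0\<close> pos by (simp add: e_def field_simps)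
        finally show ?thesis using \<phi>(1) by simp
      qed
      moreover have "e > 0" using \<open>d > 0\<close> pos by (simp add: e_def)
      ultimately show "\<exists>e>0. \<forall>\<phi>\<in>B2. ?D (\<lambda>x. \<phi> x - \<psi>2 x) < e \<longrightarrow> \<phi> \<in> ?U"
        by blast
    qed auto
    then show "openin (norm_topology B2 N2) ?U"
      using dual unfolding contained_in_dual_def by blast
    show "norm (\<integral>x. \<psi>1 x * (c * \<psi> x) \<partial>M) = norm c * norm (\<integral>x. \<psi>1 x * \<psi> x \<partial>M)" for c \<psi>
      by (simp add: mult.left_commute[of _ c] norm_mult)
  qed
qed

section \<open>From decay constants for each pair of functions to a single constant\<close>

theorem theoremB1:
  fixes M :: "'a measure" and f :: "'a \<Rightarrow> 'a" and \<gamma> :: "nat \<Rightarrow> real"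
    and B1 B2 :: "('a \<Rightarrow> 'k::{real_normed_field, banach, second_countable_topology}) set"
    and N1 N2 :: "('a \<Rightarrow> 'k) \<Rightarrow> real"
  assumes system: "ergodic_system M f"
    and gamma_decreasing: "decseq \<gamma>" and gamma_nonneg: "\<And>n. 0 \<le> \<gamma> n"
    and banach1: "banach_function_space M B1 N1"
    and banach2: "banach_function_space M B2 N2"
    and constants: "\<And>c. (\<lambda>_. c) \<in> B1"
    and integration: "integral_continuous_on M B1 N1"
    and koopman_continuous:
      "continuous_map (norm_topology B1 N1) (norm_topology B1 N1) (koopman f)"
    and duality: "contained_in_dual M B1 N1 B2 N2"
    and decay: "\<And>\<psi>1 \<psi>2. \<psi>1 \<in> B1 \<Longrightarrow> \<psi>2 \<in> B2 \<Longrightarrow>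
      \<exists>C. \<forall>n. norm ((\<integral>x. (\<psi>1 \<circ> f ^^ n) x * \<psi>2 x \<partial>M) - (\<integral>x. \<psi>1 x \<partial>M) * (\<integral>x. \<psi>2 x \<partial>M))
        \<le> C * \<gamma> n"
  shows "\<exists>K. \<forall>n. \<forall>\<psi>1\<in>B1. \<forall>\<psi>2\<in>B2.
    norm ((\<integral>x. (\<psi>1 \<circ> f ^^ n) x * \<psi>2 x \<partial>M) - (\<integral>x. \<psi>1 x \<partial>M) * (\<integral>x. \<psi>2 x \<partial>M))
      \<le> K * N1 \<psi>1 * N2 \<psi>2 * \<gamma> n"
proof -
  interpret B1: banach_function_space M B1 N1 by fact
  interpret B2: banach_function_space M B2 N2 by fact
  define L where "L n \<psi>1 \<psi>2 =
      (\<integral>x. (\<psi>1 \<circ> f ^^ n) x * \<psi>2 x \<partial>M) - (\<integral>x. \<psi>1 x \<partial>M) * (\<integral>x. \<psi>2 x \<partial>M)"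
    for n and \<psi>1 \<psi>2 :: "'a \<Rightarrow> 'k"
  have iterate: "\<exists>c\<ge>0. \<forall>\<psi>\<in>B1. \<psi> \<circ> f ^^ n \<in> B1 \<and> N1 (\<psi> \<circ> f ^^ n) \<le> c * N1 \<psi>" for n
    by (rule B1.koopman_iterate_bounded[OF koopman_continuous])
  have int_prod: "integrable M (\<lambda>x. \<psi>1 x * \<psi>2 x)" if "\<psi>1 \<in> B1" "\<psi>2 \<in> B2" for \<psi>1 \<psi>2
    using duality that by (simp add: contained_in_dual_def)
  have int_iter: "integrable M (\<lambda>x. \<psi>1 ((f ^^ n) x) * \<psi>2 x)"
    if "\<psi>1 \<in> B1" "\<psi>2 \<in> B2" for n \<psi>1 \<psi>2
  proof -
    have "\<psi>1 \<circ> f ^^ n \<in> B1" using iterate that(1) by blast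
    from int_prod[OF this that(2)] show ?thesis by simp
  qed
  have int1: "integrable M \<psi>1" if "\<psi>1 \<in> B1" for \<psi>1
    using integration that by (simp add: integral_continuous_on_def)
  \<comment> \<open>Constants lie in \<open>B1\<close>, so the integral of \<psi>2 is its pairing
    with 1.\<close>
  have int2: "integrable M \<psi>2" if "\<psi>2 \<in> B2" for \<psi>2
    using int_prod[OF constants[of 1] that] by simp
  have L_add1: "L n (\<lambda>x. \<psi> x + \<phi> x) \<psi>2 = L n \<psi> \<psi>2 + L n \<phi> \<psi>2"
    if "\<psi> \<in> B1" "\<phi> \<in> B1" "\<psi>2 \<in> B2" for n \<psi> \<phi> \<psi>2
    using that by (simp add: L_def distrib_right int1 int_iter)
  have L_add2: "L n \<psi>1 (\<lambda>x. \<psi> x + \<phi> x) = L n \<psi>1 \<psi> + L n \<psi>1 \<phi>"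
    if "\<psi>1 \<in> B1" "\<psi> \<in> B2" "\<phi> \<in> B2" for n \<psi>1 \<psi> \<phi>
    using that by (simp add: L_def distrib_left int2 int_iter)
  \<comment> \<open>Scalars leave the integral even without integrability, so no membership is
    required here.\<close>
  have L_scale1: "L n (\<lambda>x. c * \<psi>1 x) \<psi>2 = c * L n \<psi>1 \<psi>2" for n c \<psi>1 \<psi>2
    by (simp add: L_def right_diff_distrib mult.assoc)
  have L_scale2: "L n \<psi>1 (\<lambda>x. c * \<psi>2 x) = c * L n \<psi>1 \<psi>2" for n c \<psi>1 \<psi>2
    by (simp add: L_def right_diff_distrib mult.left_commute[of _ c])
  have L_bounded1: "\<exists>c. \<forall>\<psi>1\<in>B1. norm (L n \<psi>1 \<psi>2) \<le> c * N1 \<psi>1" if \<psi>2: "\<psi>2 \<in> B2" for n \<psi>2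
  proof -
    have "pairing M \<psi>2 \<in> dual_space B1 N1"
      using duality \<psi>2 by (simp add: contained_in_dual_def)
    from B1.dual_space_bounded[OF this]
    obtain a where a: "\<And>\<psi>. \<psi> \<in> B1 \<Longrightarrow> norm (\<integral>x. \<psi> x * \<psi>2 x \<partial>M) \<le> a * N1 \<psi>"
      by (auto simp: pairing_def)
    have "(\<lambda>\<psi>. \<integral>x. \<psi> x \<partial>M) \<in> dual_space B1 N1"
      using integration by (simp add: integral_continuous_on_def)
    from B1.dual_space_bounded[OF this]
    obtain b where b: "\<And>\<psi>. \<psi> \<in> B1 \<Longrightarrow> norm (\<integral>x. \<psi> x \<partial>M) \<le> b * N1 \<psi>"
      by blast
    obtain c where c: "c \<ge> 0" "\<And>\<psi>. \<psi> \<in> B1 \<Longrightarrow> \<psi> \<circ> f ^^ n \<in> B1"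
      "\<And>\<psi>. \<psi> \<in> B1 \<Longrightarrow> N1 (\<psi> \<circ> f ^^ n) \<le> c * N1 \<psi>"
      using iterate by blast
    have "norm (L n \<psi>1 \<psi>2) \<le> (\<bar>a\<bar> * c + b * norm (\<integral>x. \<psi>2 x \<partial>M)) * N1 \<psi>1" if \<psi>1: "\<psi>1 \<in> B1" for \<psi>1
    proof -
      have "norm (L n \<psi>1 \<psi>2) \<le> norm (\<integral>x. (\<psi>1 \<circ> f ^^ n) x * \<psi>2 x \<partial>M)
          + norm (\<integral>x. \<psi>1 x \<partial>M) * norm (\<integral>x. \<psi>2 x \<partial>M)"
        unfolding L_def norm_mult[symmetric] by (rule norm_triangle_ineq4)
      also have "norm (\<integral>x. (\<psi>1 \<circ> f ^^ n) x * \<psi>2 x \<partial>M) \<le> a * N1 (\<psi>1 \<circ> f ^^ n)"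
        by (rule a[OF c(2)[OF \<psi>1]])
      also have "\<dots> \<le> \<bar>a\<bar> * (c * N1 \<psi>1)"
        using c(3)[OF \<psi>1] B1.norm_nonneg[OF c(2)[OF \<psi>1]] by (intro mult_mono) auto
      also have "norm (\<integral>x. \<psi>1 x \<partial>M) * norm (\<integral>x. \<psi>2 x \<partial>M) \<le> b * N1 \<psi>1 * norm (\<integral>x. \<psi>2 x \<partial>M)"
        by (intro mult_right_mono b \<psi>1) simp
      finally show ?thesis by (simp add: algebra_simps)
    qed
    then show ?thesis by blast
  qed
  have L_bounded2: "\<exists>c. \<forall>\<psi>2\<in>B2. norm (L n \<psi>1 \<psi>2) \<le> c * N2 \<psi>2" if \<psi>1: "\<psi>1 \<in> B1" for n \<psi>1
  proof -
    have "\<psi>1 \<circ> f ^^ n \<in> B1" using iterate \<psi>1 by blast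
    from pairing_bounded[OF banach1 banach2 duality this]
    obtain a where a: "\<And>\<psi>. \<psi> \<in> B2 \<Longrightarrow> norm (\<integral>x. (\<psi>1 \<circ> f ^^ n) x * \<psi> x \<partial>M) \<le> a * N2 \<psi>"
      by blast
    \<comment> \<open>Pairing with the constant 1 shows that integration is bounded on
      \<open>B2\<close> as well.\<close>
    from pairing_bounded[OF banach1 banach2 duality constants[of 1]]
    obtain b where b: "\<And>\<psi>. \<psi> \<in> B2 \<Longrightarrow> norm (\<integral>x. \<psi> x \<partial>M) \<le> b * N2 \<psi>"
      by auto
    have "norm (L n \<psi>1 \<psi>2) \<le> (a + norm (\<integral>x. \<psi>1 x \<partial>M) * b) * N2 \<psi>2" if \<psi>2: "\<psi>2 \<in> B2" for \<psi>2
    proof -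
      have "norm (L n \<psi>1 \<psi>2) \<le> norm (\<integral>x. (\<psi>1 \<circ> f ^^ n) x * \<psi>2 x \<partial>M)
          + norm (\<integral>x. \<psi>1 x \<partial>M) * norm (\<integral>x. \<psi>2 x \<partial>M)"
        unfolding L_def norm_mult[symmetric] by (rule norm_triangle_ineq4)
      also have "\<dots> \<le> a * N2 \<psi>2 + norm (\<integral>x. \<psi>1 x \<partial>M) * (b * N2 \<psi>2)"
        by (intro add_mono mult_left_mono a b \<psi>2) simp
      finally show ?thesis by (simp add: algebra_simps)
    qed
    then show ?thesis by blast
  qed
  \<comment> \<open>With \<open>x / 0 = 0\<close> the quotient \<open>Q\<close> is harmless at \<open>\<gamma> n = 0\<close>, where \<open>L n\<close> vanishes by the decay
    hypothesis.\<close>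
  define Q where "Q n \<psi>1 \<psi>2 = norm (L n \<psi>1 \<psi>2) / \<gamma> n" for n \<psi>1 \<psi>2
  have Q_bounded: "\<exists>c. \<forall>n. Q n \<psi>1 \<psi>2 \<le> c \<and> norm (L n \<psi>1 \<psi>2) = Q n \<psi>1 \<psi>2 * \<gamma> n"
    if \<psi>: "\<psi>1 \<in> B1" "\<psi>2 \<in> B2" for \<psi>1 \<psi>2
  proof -
    obtain C where C: "\<And>n. norm (L n \<psi>1 \<psi>2) \<le> C * \<gamma> n"
      using decay[OF \<psi>] unfolding L_def by blast
    \<comment> \<open>If \<gamma> n = 0, then the quotient is 0 while C may be negative, hence
      |C|.\<close>
    have "Q n \<psi>1 \<psi>2 \<le> \<bar>C\<bar> \<and> norm (L n \<psi>1 \<psi>2) = Q n \<psi>1 \<psi>2 * \<gamma> n" for n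
    proof (cases "\<gamma> n = 0")
      case True
      then show ?thesis using C[of n] by (simp add: Q_def)
    next
      case False
      then have "\<gamma> n > 0" using gamma_nonneg[of n] by simp
      then have "Q n \<psi>1 \<psi>2 \<le> C" using C[of n] by (simp add: Q_def field_simps)
      then show ?thesis using False by (simp add: Q_def)
    qed
    then show ?thesis by blast
  qed
  have first: "\<exists>c. \<forall>n. \<forall>\<psi>2\<in>B2. Q n \<psi>1 \<psi>2 \<le> c * N2 \<psi>2" if \<psi>1: "\<psi>1 \<in> B1" for \<psi>1
  proof -
    have "\<exists>K. \<forall>n\<in>UNIV. \<forall>\<psi>2\<in>B2. Q n \<psi>1 \<psi>2 \<le> K * N2 \<psi>2"
    proof (rule B2.uniform_boundedness)
      fix n :: nat
      show "Q n \<psi>1 (\<lambda>x. \<psi> x + \<phi> x) \<le> Q n \<psi>1 \<psi> + Q n \<psi>1 \<phi>" if "\<psi> \<in> B2" "\<phi> \<in> B2" for \<psi> \<phi>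
        using that \<psi>1 gamma_nonneg[of n]
        by (simp add: Q_def L_add2 add_divide_distrib[symmetric] divide_right_mono norm_triangle_ineq)
      show "Q n \<psi>1 (\<lambda>x. c * \<psi> x) = norm c * Q n \<psi>1 \<psi>" for c \<psi>
        by (simp add: Q_def L_scale2 norm_mult)
      obtain c where c: "\<And>\<psi>2. \<psi>2 \<in> B2 \<Longrightarrow> norm (L n \<psi>1 \<psi>2) \<le> c * N2 \<psi>2"
        using L_bounded2[OF \<psi>1] by blast
      have "Q n \<psi>1 \<psi>2 \<le> c / \<gamma> n * N2 \<psi>2" if "\<psi>2 \<in> B2" for \<psi>2
        using divide_right_mono[OF c[OF that] gamma_nonneg[of n]] by (simp add: Q_def)
      then show "\<exists>c. \<forall>\<psi>2\<in>B2. Q n \<psi>1 \<psi>2 \<le> c * N2 \<psi>2" by blast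
    next
      show "\<exists>c. \<forall>n\<in>UNIV. Q n \<psi>1 \<psi>2 \<le> c" if "\<psi>2 \<in> B2" for \<psi>2
        using Q_bounded[OF \<psi>1 that] by blast
    qed
    then show ?thesis by simp
  qed
  \<comment> \<open>Indexing by pairs makes the constant uniform in n and \<psi>2 together. The
    constant of \<open>first\<close> depends on \<psi>1 only, which is exactly pointwise boundedness
    of this family.\<close>
  have "\<exists>K. \<forall>i\<in>UNIV \<times> B2. \<forall>\<psi>1\<in>B1. Q (fst i) \<psi>1 (snd i) / N2 (snd i) \<le> K * N1 \<psi>1"
  proof (rule B1.uniform_boundedness)
    fix i :: "nat \<times> ('a \<Rightarrow> 'k)" assume "i \<in> UNIV \<times> B2"
    then obtain n \<psi>2 where i: "i = (n, \<psi>2)" and \<psi>2: "\<psi>2 \<in> B2" by auto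
    note nonneg = gamma_nonneg[of n] B2.norm_nonneg[OF \<psi>2]
    show "Q (fst i) (\<lambda>x. \<psi> x + \<phi> x) (snd i) / N2 (snd i)
        \<le> Q (fst i) \<psi> (snd i) / N2 (snd i) + Q (fst i) \<phi> (snd i) / N2 (snd i)"
      if "\<psi> \<in> B1" "\<phi> \<in> B1" for \<psi> \<phi>
      using that \<psi>2 nonneg
      by (simp add: i Q_def L_add1 add_divide_distrib[symmetric] divide_right_mono norm_triangle_ineq)
    show "Q (fst i) (\<lambda>x. c * \<psi> x) (snd i) / N2 (snd i) = norm c * (Q (fst i) \<psi> (snd i) / N2 (snd i))"
      for c \<psi>
      by (simp add: Q_def L_scale1 norm_mult)
    obtain c where c: "\<And>\<psi>1. \<psi>1 \<in> B1 \<Longrightarrow> norm (L n \<psi>1 \<psi>2) \<le> c * N1 \<psi>1"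
      using L_bounded1[OF \<psi>2] by blast
    have "Q n \<psi>1 \<psi>2 / N2 \<psi>2 \<le> c / \<gamma> n / N2 \<psi>2 * N1 \<psi>1" if "\<psi>1 \<in> B1" for \<psi>1
      using divide_right_mono[OF divide_right_mono[OF c[OF that] nonneg(1)] nonneg(2)]
      by (simp add: Q_def)
    then show "\<exists>c. \<forall>\<psi>1\<in>B1. Q (fst i) \<psi>1 (snd i) / N2 (snd i) \<le> c * N1 \<psi>1"
      unfolding i fst_conv snd_conv by blast
  next
    fix \<psi>1 assume \<psi>1: "\<psi>1 \<in> B1"
    obtain c where c: "\<And>n \<psi>2. \<psi>2 \<in> B2 \<Longrightarrow> Q n \<psi>1 \<psi>2 \<le> c * N2 \<psi>2"
      using first[OF \<psi>1] by blast
    have "Q n \<psi>1 \<psi>2 / N2 \<psi>2 \<le> \<bar>c\<bar>" if "\<psi>2 \<in> B2" for n \<psi>2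
    proof (cases "N2 \<psi>2 = 0")
      case False
      then have "N2 \<psi>2 > 0" using B2.norm_nonneg[OF that] by simp
      then have "Q n \<psi>1 \<psi>2 / N2 \<psi>2 \<le> c" using c[OF that] by (simp add: field_simps)
      then show ?thesis by simp
    qed simp
    then show "\<exists>c. \<forall>i\<in>UNIV \<times> B2. Q (fst i) \<psi>1 (snd i) / N2 (snd i) \<le> c"
      by (intro exI[of _ "\<bar>c\<bar>"]) auto
  qed
  then obtain K where K: "\<And>n \<psi>1 \<psi>2. \<psi>1 \<in> B1 \<Longrightarrow> \<psi>2 \<in> B2 \<Longrightarrow> Q n \<psi>1 \<psi>2 / N2 \<psi>2 \<le> K * N1 \<psi>1"
    by force
  have "norm (L n \<psi>1 \<psi>2) \<le> K * N1 \<psi>1 * N2 \<psi>2 * \<gamma> n" if \<psi>: "\<psi>1 \<in> B1" "\<psi>2 \<in> B2" for n \<psi>1 \<psi>2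
  proof -
    have "Q n \<psi>1 \<psi>2 \<le> K * N1 \<psi>1 * N2 \<psi>2"
    proof (cases "N2 \<psi>2 = 0")
      \<comment> \<open>The quotient by \<open>N2 \<psi>2\<close> is 0 by convention and carries no
        information here; \<open>first\<close> shows directly that
        \<open>Q n \<psi>1 \<psi>2\<close> is at most 0.\<close>
      case True
      then show ?thesis using first[OF \<psi>(1)] \<psi>(2) by fastforce
    next
      case False
      then have "N2 \<psi>2 > 0" using B2.norm_nonneg[OF \<psi>(2)] by simp
      then show ?thesis using K[OF \<psi>, of n] by (simp add: field_simps)
    qed
    then have "Q n \<psi>1 \<psi>2 * \<gamma> n \<le> K * N1 \<psi>1 * N2 \<psi>2 * \<gamma> n"
      by (rule mult_right_mono[OF _ gamma_nonneg])
    then show ?thesis using Q_bounded[OF \<psi>] by auto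
  qed
  then show ?thesis unfolding L_def by blast
qed

end
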